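(* Let $\varphi$ be a formula of the language $\mathcal{L}$. Then $\varphi$ is satisfiable relative to the class $\mathbf{MCM}$ of multi-classifier models if and only if $\varphi$ is satisfiable relative to the class $\mathbf{MDM}$ of multi-decision models.
   Context: Let $\mathit{Atm}_0$ be a countable (finite or infinite) set of atomic propositions (input variables) and $\mathit{Val}$ a finite set of output values. For each $x\in\mathit{Val}$ there is a decision atom $\mathsf{t}(x)$; $\mathit{Dec}=\{\mathsf{t}(x): x\in\mathit{Val}\}$ and $\mathit{Atm}=\mathit{Atm}_0\cup\mathit{Dec}$. The language $\mathcal{L}$ is given by $\varphi ::= p \mid \mathsf{t}(x)\mid \neg\varphi\mid \varphi\wedge\varphi\mid \Box_{\mathtt{I}}\varphi\mid \Box_{\mathtt{F}}\varphi$ with $p\in\mathit{Atm}_0$, $x\in\mathit{Val}$. A multi-classifier model (MCM) is a pair $\Gamma=(S,\Phi)$ with $S\subseteq 2^{\mathit{Atm}_0}$ and $\Phi$ a set of functions from $S$ to $\mathit{Val}$. For $s\in S$, $f\in\Phi$: $(\Gamma,s,f)\models p$ iff $p\in s$; $(\Gamma,s,f)\models\mathsf{t}(x)$ iff $f(s)=x$; Boolean connectives as usual; $(\Gamma,s,f)\models\Box_{\mathtt{I}}\varphi$ iff $(\Gamma,s',f)\models\varphi$ for all $s'\in S$; $(\Gamma,s,f)\models\Box_{\mathtt{F}}\varphi$ iff $(\Gamma,s,f')\models\varphi$ for all $f'\in\Phi$. $\varphi$ is satisfiable relative to $\mathbf{MCM}$ if $(\Gamma,s,f)\models\varphi$ for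 some MCM $\Gamma=(S,\Phi)$, $s\in S$, $f\in\Phi$. A multi-decision model (MDM) is a tuple $M=(W,\sim_{\Box_{\mathtt{I}}},\sim_{\Box_{\mathtt{F}}},V)$ with $W$ a set of worlds, $\sim_{\Box_{\mathtt{I}}},\sim_{\Box_{\mathtt{F}}}$ equivalence relations on $W$, and $V:W\to 2^{\mathit{Atm}}$, writing $V_Y(w)=V(w)\cap Y$, such that for all $w,v\in W$, $x,y\in\mathit{Val}$: (C1) $\sim_{\Box_{\mathtt{I}}}\circ\sim_{\Box_{\mathtt{F}}}=\sim_{\Box_{\mathtt{F}}}\circ\sim_{\Box_{\mathtt{I}}}$; (C2) if $V_{\mathit{Atm}_0}(w)=V_{\mathit{Atm}_0}(v)$ and $w\sim_{\Box_{\mathtt{I}}}v$ then $V_{\mathit{Dec}}(w)=V_{\mathit{Dec}}(v)$; (C3) if $w\sim_{\Box_{\mathtt{F}}}v$ then $V_{\mathit{Atm}_0}(w)=V_{\mathit{Atm}_0}(v)$; (C4) if $\mathsf{t}(x)\in V(w)$ and $x\neq y$ then $\mathsf{t}(y)\notin V(w)$; (C5) there is $x\in\mathit{Val}$ with $\mathsf{t}(x)\in V(w)$. Truth at $(M,w)$: atoms $q\in\mathit{Atm}$ are true iff $q\in V(w)$; Boolean connectives as usual; $\Box_{\mathtt{I}}\varphi$ (resp. $\Box_{\mathtt{F}}\varphi$) is true iff $\varphi$ is true at every $v$ with $w\sim_{\Box_{\mathtt{I}}}v$ (resp. $w\sim_{\Box_{\mathtt{F}}}v$). Satisfiability relative to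 $\mathbf{MDM}$ is defined in the usual way. *)

theory Defs
  imports "HOL-Library.FuncSet" "HOL-Library.Countable_Set"
begin

datatype ('p, 'v) atom = Inp 'p | Decision 'v  (\<open>\<t>'(_')\<close>)

definition Dec :: "'v set \<Rightarrow> ('p, 'v) atom set" where
  "Dec Val = {\<t>(x) | x. x \<in> Val}"

definition Atm :: "'p set \<Rightarrow> 'v set \<Rightarrow> ('p, 'v) atom set" where
  "Atm Atm0 Val = Inp ` Atm0 \<union> Dec Val"

datatype ('p, 'v) fm =
    At "('p, 'v) atom"
  | Neg "('p, 'v) fm"
  | Conj "('p, 'v) fm" "('p, 'v) fm"
  | BoxI "('p, 'v) fm"
  | BoxF "('p, 'v) fm"

text \<open>\<open>Atm0\<close> and \<open>Val\<close> are sets rather than whole types, so that either may be empty;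
  hence the language has to be carved out of the formula type.\<close>

inductive_set language :: "'p set \<Rightarrow> 'v set \<Rightarrow> ('p, 'v) fm set"
  for Atm0 :: "'p set" and Val :: "'v set" where
  inp: "p \<in> Atm0 \<Longrightarrow> At (Inp p) \<in> language Atm0 Val"
| dec: "x \<in> Val \<Longrightarrow> At (\<t>(x)) \<in> language Atm0 Val"
| neg: "\<phi> \<in> language Atm0 Val \<Longrightarrow> Neg \<phi> \<in> language Atm0 Val"
| conj: "\<phi> \<in> language Atm0 Val \<Longrightarrow> \<psi> \<in> language Atm0 Val \<Longrightarrow> Conj \<phi> \<psi> \<in> language Atm0 Val"
| boxI: "\<phi> \<in> language Atm0 Val \<Longrightarrow> BoxI \<phi> \<in> language Atm0 Val"
| boxF: "\<phi> \<in> language Atm0 Val \<Longrightarrow> BoxF \<phi> \<in> language Atm0 Val"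

record ('p, 'v) mcm =
  states :: "'p set set"
  classifiers :: "('p set \<Rightarrow> 'v) set"

text \<open>Functions from \<open>S\<close> to \<open>Val\<close> are taken extensionally, so that two elements of
  \<open>\<Phi>\<close> agreeing on \<open>S\<close> are equal.\<close>

definition is_mcm :: "'p set \<Rightarrow> 'v set \<Rightarrow> ('p, 'v) mcm \<Rightarrow> bool" where
  "is_mcm Atm0 Val \<Gamma> \<longleftrightarrow>
     states \<Gamma> \<subseteq> Pow Atm0 \<and> classifiers \<Gamma> \<subseteq> (states \<Gamma> \<rightarrow>\<^sub>E Val)"

primrec mcm_true :: "('p, 'v) mcm \<Rightarrow> 'p set \<Rightarrow> ('p set \<Rightarrow> 'v) \<Rightarrow> ('p, 'v) fm \<Rightarrow> bool" where
  "mcm_true \<Gamma> s f (At q) \<longleftrightarrow> (case q of Inp p \<Rightarrow> p \<in> s | \<t>(x) \<Rightarrow> f s = x)"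
| "mcm_true \<Gamma> s f (Neg \<phi>) \<longleftrightarrow> \<not> mcm_true \<Gamma> s f \<phi>"
| "mcm_true \<Gamma> s f (Conj \<phi> \<psi>) \<longleftrightarrow> mcm_true \<Gamma> s f \<phi> \<and> mcm_true \<Gamma> s f \<psi>"
| "mcm_true \<Gamma> s f (BoxI \<phi>) \<longleftrightarrow> (\<forall>s'\<in>states \<Gamma>. mcm_true \<Gamma> s' f \<phi>)"
| "mcm_true \<Gamma> s f (BoxF \<phi>) \<longleftrightarrow> (\<forall>f'\<in>classifiers \<Gamma>. mcm_true \<Gamma> s f' \<phi>)"

definition mcm_satisfiable :: "'p set \<Rightarrow> 'v set \<Rightarrow> ('p, 'v) fm \<Rightarrow> bool" where
  "mcm_satisfiable Atm0 Val \<phi> \<longleftrightarrow>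
     (\<exists>\<Gamma>. is_mcm Atm0 Val \<Gamma> \<and> (\<exists>s\<in>states \<Gamma>. \<exists>f\<in>classifiers \<Gamma>. mcm_true \<Gamma> s f \<phi>))"

record ('w, 'p, 'v) mdm =
  worlds :: "'w set"
  simI :: "('w \<times> 'w) set"
  simF :: "('w \<times> 'w) set"
  val :: "'w \<Rightarrow> ('p, 'v) atom set"

definition is_mdm :: "'p set \<Rightarrow> 'v set \<Rightarrow> ('w, 'p, 'v) mdm \<Rightarrow> bool" where
  "is_mdm Atm0 Val M \<longleftrightarrow>
     equiv (worlds M) (simI M) \<and> equiv (worlds M) (simF M) \<and>
     (\<forall>w\<in>worlds M. val M w \<subseteq> Atm Atm0 Val) \<and>
     simI M O simF M = simF M O simI M \<and>
     (\<forall>w\<in>worlds M. \<forall>v\<in>worlds M.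
        val M w \<inter> Inp ` Atm0 = val M v \<inter> Inp ` Atm0 \<and> (w, v) \<in> simI M \<longrightarrow>
        val M w \<inter> Dec Val = val M v \<inter> Dec Val) \<and>
     (\<forall>w\<in>worlds M. \<forall>v\<in>worlds M.
        (w, v) \<in> simF M \<longrightarrow> val M w \<inter> Inp ` Atm0 = val M v \<inter> Inp ` Atm0) \<and>
     (\<forall>w\<in>worlds M. \<forall>x\<in>Val. \<forall>y\<in>Val. \<t>(x) \<in> val M w \<and> x \<noteq> y \<longrightarrow> \<t>(y) \<notin> val M w) \<and>
     (\<forall>w\<in>worlds M. \<exists>x\<in>Val. \<t>(x) \<in> val M w)"

primrec mdm_true :: "('w, 'p, 'v) mdm \<Rightarrow> 'w \<Rightarrow> ('p, 'v) fm \<Rightarrow> bool" where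
  "mdm_true M w (At q) \<longleftrightarrow> q \<in> val M w"
| "mdm_true M w (Neg \<phi>) \<longleftrightarrow> \<not> mdm_true M w \<phi>"
| "mdm_true M w (Conj \<phi> \<psi>) \<longleftrightarrow> mdm_true M w \<phi> \<and> mdm_true M w \<psi>"
| "mdm_true M w (BoxI \<phi>) \<longleftrightarrow> (\<forall>v. (w, v) \<in> simI M \<longrightarrow> mdm_true M v \<phi>)"
| "mdm_true M w (BoxF \<phi>) \<longleftrightarrow> (\<forall>v. (w, v) \<in> simF M \<longrightarrow> mdm_true M v \<phi>)"

text \<open>HOL cannot quantify over all sets of worlds of all types inside a formula, so the type
  the worlds are drawn from is an explicit parameter. A claim about all multi-decision models
  leaves \<open>'w\<close> free; for the existence of one, state-classifier pairs, of type
  \<open>'p set \<times> ('p set \<Rightarrow> 'v)\<close>, are natural worlds.\<close>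

definition mdm_satisfiable :: "'w itself \<Rightarrow> 'p set \<Rightarrow> 'v set \<Rightarrow> ('p, 'v) fm \<Rightarrow> bool" where
  "mdm_satisfiable T Atm0 Val \<phi> \<longleftrightarrow>
     (\<exists>M :: ('w, 'p, 'v) mdm. is_mdm Atm0 Val M \<and> (\<exists>w\<in>worlds M. mdm_true M w \<phi>))"

end

theory Submission
  imports Defs
begin

text \<open>A multi-classifier model becomes a multi-decision model on the set of pairs (state, classifier).
  Conversely, restrict a multi-decision model to the worlds reachable from the given one. There
  every \<open>\<box>\<^sub>I\<close>-class meets every \<open>\<box>\<^sub>F\<close>-class, so by (C2) and (C3) each \<open>\<box>\<^sub>I\<close>-class induces a total
  classifier on the occurring input valuations. Sending a world to its input valuation and
  the classifier of its \<open>\<box>\<^sub>I\<close>-class is then a bounded morphism. Distinct \<open>\<box>\<^sub>F\<close>-classes with the same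
  inputs are identified by it, which is harmless because (C2) forces their decisions to agree.\<close>

section \<open>From classifiers to worlds\<close>

definition mdm_of_mcm :: "('p, 'v) mcm \<Rightarrow> ('p set \<times> ('p set \<Rightarrow> 'v), 'p, 'v) mdm" where
  "mdm_of_mcm \<Gamma> =
     \<lparr>worlds = states \<Gamma> \<times> classifiers \<Gamma>,
      simI = {((s, f), (s', f)) | s s' f. s \<in> states \<Gamma> \<and> s' \<in> states \<Gamma> \<and> f \<in> classifiers \<Gamma>},
      simF = {((s, f), (s, f')) | s f f'. s \<in> states \<Gamma> \<and> f \<in> classifiers \<Gamma> \<and> f' \<in> classifiers \<Gamma>},
      val = (\<lambda>(s, f). insert (\<t>(f s)) (Inp ` s))\<rparr>"

text \<open>Both compositions in (C1) are the full relation on the product. For (C2), a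
  \<open>simI\<close>-step fixes the classifier and equal inputs fix the state. (C4) and (C5) hold
  because each world carries exactly one decision atom.\<close>

lemma is_mdm_mdm_of_mcm:
  assumes "is_mcm Atm0 Val \<Gamma>"
  shows "is_mdm Atm0 Val (mdm_of_mcm \<Gamma>)"
proof -
  have sub: "s \<subseteq> Atm0" if "s \<in> states \<Gamma>" for s
    using assms that by (auto simp: is_mcm_def)
  have fs: "f s \<in> Val" if "s \<in> states \<Gamma>" "f \<in> classifiers \<Gamma>" for s f
    using assms that by (auto simp: is_mcm_def)
  have inputs: "insert (\<t>(x)) (Inp ` s) \<inter> Inp ` Atm0 = Inp ` s" if "s \<in> states \<Gamma>" for s and x :: 'b
    using sub[OF that] by auto
  have inj: "Inp ` s = Inp ` s' \<longleftrightarrow> s = s'" for s s' :: "'a set"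
    by (rule inj_image_eq_iff) (simp add: inj_on_def)
  have "equiv (worlds (mdm_of_mcm \<Gamma>)) (simI (mdm_of_mcm \<Gamma>))"
    and "equiv (worlds (mdm_of_mcm \<Gamma>)) (simF (mdm_of_mcm \<Gamma>))"
    by (auto simp: mdm_of_mcm_def equiv_def refl_on_def sym_def trans_def)
  moreover have "simI (mdm_of_mcm \<Gamma>) O simF (mdm_of_mcm \<Gamma>) = simF (mdm_of_mcm \<Gamma>) O simI (mdm_of_mcm \<Gamma>)"
    by (auto simp: mdm_of_mcm_def relcomp_unfold)
  ultimately show ?thesis
    unfolding is_mdm_def using fs subsetD[OF sub]
    by (auto simp: mdm_of_mcm_def inputs inj Atm_def Dec_def)
qed

lemma mdm_true_mdm_of_mcm:
  assumes "s \<in> states \<Gamma>" "f \<in> classifiers \<Gamma>"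
  shows "mdm_true (mdm_of_mcm \<Gamma>) (s, f) \<phi> \<longleftrightarrow> mcm_true \<Gamma> s f \<phi>"
  using assms
proof (induction \<phi> arbitrary: s f)
  case (At q)
  then show ?case by (cases q) (auto simp: mdm_of_mcm_def)
next
  case (BoxI \<phi>)
  have "((s, f), v) \<in> simI (mdm_of_mcm \<Gamma>) \<longleftrightarrow> (\<exists>s'\<in>states \<Gamma>. v = (s', f))" for v
    using BoxI.prems by (auto simp: mdm_of_mcm_def)
  then show ?case using BoxI by auto
next
  case (BoxF \<phi>)
  have "((s, f), v) \<in> simF (mdm_of_mcm \<Gamma>) \<longleftrightarrow> (\<exists>f'\<in>classifiers \<Gamma>. v = (s, f'))" for v
    using BoxF.prems by (auto simp: mdm_of_mcm_def)
  then show ?case using BoxF by auto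
qed auto

lemma mcm_satisfiable_imp_mdm_satisfiable:
  fixes Atm0 :: "'p set" and Val :: "'v set"
  assumes "mcm_satisfiable Atm0 Val \<phi>"
  shows "mdm_satisfiable TYPE('p set \<times> ('p set \<Rightarrow> 'v)) Atm0 Val \<phi>"
proof -
  obtain \<Gamma> s f where *: "is_mcm Atm0 Val \<Gamma>" "s \<in> states \<Gamma>" "f \<in> classifiers \<Gamma>" "mcm_true \<Gamma> s f \<phi>"
    using assms by (auto simp: mcm_satisfiable_def)
  moreover have "(s, f) \<in> worlds (mdm_of_mcm \<Gamma>)"
    using * by (simp add: mdm_of_mcm_def)
  ultimately show ?thesis
    unfolding mdm_satisfiable_def using is_mdm_mdm_of_mcm mdm_true_mdm_of_mcm by blast
qed

section \<open>From worlds to classifiers\<close>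

definition inputs :: "('w, 'p, 'v) mdm \<Rightarrow> 'w \<Rightarrow> 'p set" where
  "inputs M w = {p. Inp p \<in> val M w}"

text \<open>One composition already captures reachability: by (C1) it is an equivalence relation
  containing \<open>simI\<close> and \<open>simF\<close>.\<close>

definition component :: "('w, 'p, 'v) mdm \<Rightarrow> 'w \<Rightarrow> 'w set" where
  "component M w = (simI M O simF M) `` {w}"

text \<open>The set \<open>C\<close> fixes a common domain for all classifiers; restricting to it
  makes them extensional functions, as \<open>is_mcm\<close> demands.\<close>

definition classifier_of :: "('w, 'p, 'v) mdm \<Rightarrow> 'w set \<Rightarrow> 'w \<Rightarrow> 'p set \<Rightarrow> 'v" where
  "classifier_of M C w = (\<lambda>s\<in>inputs M ` C. THE x. \<exists>u. (w, u) \<in> simI M \<and> inputs M u = s \<and> \<t>(x) \<in> val M u)"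

definition mcm_of_mdm :: "('w, 'p, 'v) mdm \<Rightarrow> 'w \<Rightarrow> ('p, 'v) mcm" where
  "mcm_of_mdm M w =
     \<lparr>states = inputs M ` component M w,
      classifiers = classifier_of M (component M w) ` component M w\<rparr>"

context
  fixes Atm0 :: "'p set" and Val :: "'v set" and M :: "('w, 'p, 'v) mdm"
  assumes mdm: "is_mdm Atm0 Val M"
begin

lemma equiv_simI: "equiv (worlds M) (simI M)" and equiv_simF: "equiv (worlds M) (simF M)"
  and commute: "simI M O simF M = simF M O simI M"
  and val_subset: "w \<in> worlds M \<Longrightarrow> val M w \<subseteq> Atm Atm0 Val"
  using mdm by (auto simp: is_mdm_def)

lemma simI_worlds: "(w, v) \<in> simI M \<Longrightarrow> w \<in> worlds M \<and> v \<in> worlds M"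
  and simF_worlds: "(w, v) \<in> simF M \<Longrightarrow> w \<in> worlds M \<and> v \<in> worlds M"
  using equiv_simI equiv_simF by (auto dest: equiv_type)

lemma simI_refl: "w \<in> worlds M \<Longrightarrow> (w, w) \<in> simI M"
  and simF_refl: "w \<in> worlds M \<Longrightarrow> (w, w) \<in> simF M"
  using equiv_simI equiv_simF by (auto simp: equiv_def refl_on_def)

lemma simI_sym: "(w, v) \<in> simI M \<Longrightarrow> (v, w) \<in> simI M"
  and simF_sym: "(w, v) \<in> simF M \<Longrightarrow> (v, w) \<in> simF M"
  using equiv_simI equiv_simF by (auto simp: equiv_def sym_def)

lemma simI_trans: "(u, v) \<in> simI M \<Longrightarrow> (v, w) \<in> simI M \<Longrightarrow> (u, w) \<in> simI M"
  and simF_trans: "(u, v) \<in> simF M \<Longrightarrow> (v, w) \<in> simF M \<Longrightarrow> (u, w) \<in> simF M"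
  using equiv_simI equiv_simF by (meson equivE transE)+

lemma equiv_simI_simF: "equiv (worlds M) (simI M O simF M)"
proof (rule equivI)
  show "simI M O simF M \<subseteq> worlds M \<times> worlds M"
    using simI_worlds simF_worlds by auto
  show "refl_on (worlds M) (simI M O simF M)"
    using simI_refl simF_refl by (auto simp: refl_on_def)
  show "sym (simI M O simF M)"
    unfolding sym_def
  proof (intro allI impI)
    fix a b assume "(a, b) \<in> simI M O simF M"
    then have "(b, a) \<in> simF M O simI M"
      using simI_sym simF_sym by blast
    then show "(b, a) \<in> simI M O simF M"
      using commute by simp
  qed
  show "trans (simI M O simF M)"
  proof (rule transI)
    fix a b c assume "(a, b) \<in> simI M O simF M" "(b, c) \<in> simI M O simF M"
    then obtain u v where u: "(a, u) \<in> simI M" "(u, b) \<in> simF M"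
      and v: "(b, v) \<in> simI M" "(v, c) \<in> simF M" by blast
    \<comment> \<open>The middle steps form an \<open>F\<close>-step followed by an
      \<open>I\<close>-step; swapping them by (C1) puts the two \<open>I\<close>-steps and the two
      \<open>F\<close>-steps side by side.\<close>
    then have "(u, v) \<in> simI M O simF M"
      using commute by blast
    then show "(a, c) \<in> simI M O simF M"
      using u v simI_trans simF_trans by blast
  qed
qed

lemma inputs_subset: "w \<in> worlds M \<Longrightarrow> inputs M w \<subseteq> Atm0"
  using val_subset by (fastforce simp: inputs_def Atm_def Dec_def)

lemma val_Inp_eq: "w \<in> worlds M \<Longrightarrow> val M w \<inter> Inp ` Atm0 = Inp ` inputs M w"
  using inputs_subset by (auto simp: inputs_def)

lemma simF_inputs:
  assumes "(w, v) \<in> simF M"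
  shows "inputs M w = inputs M v"
proof -
  have "val M w \<inter> Inp ` Atm0 = val M v \<inter> Inp ` Atm0"
    using mdm assms simF_worlds[OF assms] unfolding is_mdm_def by blast
  then have "(Inp :: 'p \<Rightarrow> ('p, 'v) atom) ` inputs M w = Inp ` inputs M v"
    using val_Inp_eq simF_worlds[OF assms] by simp
  then show ?thesis by auto
qed

lemma decision_in_Val: "w \<in> worlds M \<Longrightarrow> \<t>(x) \<in> val M w \<Longrightarrow> x \<in> Val"
  using val_subset by (fastforce simp: Atm_def Dec_def)

lemma decision_exists: "w \<in> worlds M \<Longrightarrow> \<exists>x\<in>Val. \<t>(x) \<in> val M w"
  using mdm by (auto simp: is_mdm_def)

lemma decision_unique:
  assumes "(w, v) \<in> simI M" "inputs M w = inputs M v" "\<t>(x) \<in> val M w" "\<t>(y) \<in> val M v"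
  shows "x = y"
proof -
  have w: "w \<in> worlds M" and v: "v \<in> worlds M"
    using assms simI_worlds by auto
  moreover have "val M w \<inter> Inp ` Atm0 = val M v \<inter> Inp ` Atm0"
    using w v assms val_Inp_eq by simp
  ultimately have "val M w \<inter> Dec Val = val M v \<inter> Dec Val"
    using assms(1) mdm unfolding is_mdm_def by blast
  \<comment> \<open>(C2) and (C4) speak only of values in \<open>Val\<close>. The former moves
    \<open>x\<close> from \<open>w\<close> to \<open>v\<close>, the latter then compares it with
    \<open>y\<close>.\<close>
  moreover have xy: "x \<in> Val" "y \<in> Val"
    using assms w v decision_in_Val by auto
  ultimately have "\<t>(x) \<in> val M v"
    using assms by (auto simp: Dec_def)
  then show ?thesis
    using assms(4) v xy mdm unfolding is_mdm_def by blast
qed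

text \<open>The world \<open>u\<close> witnesses existence for the description. Any competitor lies
  in the same \<open>simI\<close>-class with the same inputs, so \<open>decision_unique\<close>
  applies.\<close>

lemma classifier_of_eq:
  assumes "(w, u) \<in> simI M" "u \<in> C" "\<t>(x) \<in> val M u"
  shows "classifier_of M C w (inputs M u) = x"
proof -
  have "(THE x. \<exists>u'. (w, u') \<in> simI M \<and> inputs M u' = inputs M u \<and> \<t>(x) \<in> val M u') = x"
  proof (rule the_equality)
    fix y assume "\<exists>u'. (w, u') \<in> simI M \<and> inputs M u' = inputs M u \<and> \<t>(y) \<in> val M u'"
    then show "y = x"
      using assms decision_unique simI_trans simI_sym by metis
  qed (use assms in blast)
  then show ?thesis
    using assms by (simp add: classifier_of_def)
qed

lemma classifier_of_cong:
  assumes "(w, v) \<in> simI M"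
  shows "classifier_of M C w = classifier_of M C v"
proof -
  have "(w, u) \<in> simI M \<longleftrightarrow> (v, u) \<in> simI M" for u
    using assms simI_trans simI_sym by blast
  then show ?thesis by (simp add: classifier_of_def)
qed

context
  fixes w0 assumes w0: "w0 \<in> worlds M"
begin

lemma component_worlds: "w \<in> component M w0 \<Longrightarrow> w \<in> worlds M"
  using simF_worlds by (auto simp: component_def)

lemma self_in_component: "w0 \<in> component M w0"
  using w0 simI_refl simF_refl by (auto simp: component_def)

text \<open>Supplies the intermediate world on which totality of the classifiers and both box cases
  rest.\<close>

lemma component_connected:
  assumes "w \<in> component M w0" "v \<in> component M w0"
  shows "(w, v) \<in> simI M O simF M"
  using assms equiv_simI_simF unfolding component_def
  by (metis Image_singleton_iff equivE symE transE)

lemma component_simI: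
  assumes "w \<in> component M w0" "(w, v) \<in> simI M"
  shows "v \<in> component M w0"
proof -
  have "(w, v) \<in> simI M O simF M"
    using assms simI_worlds simF_refl by blast
  then show ?thesis
    using assms equiv_simI_simF unfolding component_def
    by (metis Image_singleton_iff equivE transE)
qed

lemma component_simF:
  assumes "w \<in> component M w0" "(w, v) \<in> simF M"
  shows "v \<in> component M w0"
  using assms simF_trans unfolding component_def by blast

lemma is_mcm_mcm_of_mdm: "is_mcm Atm0 Val (mcm_of_mdm M w0)"
proof -
  have "classifier_of M (component M w0) w (inputs M v) \<in> Val"
    if w: "w \<in> component M w0" and v: "v \<in> component M w0" for w v
  proof -
    \<comment> \<open>The \<open>simI\<close>-class of \<open>w\<close> may miss \<open>v\<close>,
      but it contains some \<open>u\<close> with the inputs of \<open>v\<close>, by (C3).\<close>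
    obtain u where u: "(w, u) \<in> simI M" "(u, v) \<in> simF M"
      using component_connected[OF w v] by blast
    obtain x where x: "x \<in> Val" "\<t>(x) \<in> val M u"
      using decision_exists simI_worlds u by blast
    have "classifier_of M (component M w0) w (inputs M u) = x"
      using classifier_of_eq component_simI w u x by blast
    then show ?thesis using x simF_inputs[OF u(2)] by simp
  qed
  moreover have "classifier_of M C w \<in> extensional (inputs M ` C)" for C w
    by (simp add: classifier_of_def)
  moreover have "inputs M w \<subseteq> Atm0" if "w \<in> component M w0" for w
    using inputs_subset component_worlds that by blast
  ultimately show ?thesis
    by (auto simp: is_mcm_def mcm_of_mdm_def PiE_iff image_subset_iff)
qed

lemma mcm_true_mcm_of_mdm:
  assumes "\<phi> \<in> language Atm0 Val" "w \<in> component M w0"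
  shows "mcm_true (mcm_of_mdm M w0) (inputs M w) (classifier_of M (component M w0) w) \<phi>
    \<longleftrightarrow> mdm_true M w \<phi>"
  using assms
proof (induction arbitrary: w rule: language.induct)
  case (inp p)
  then show ?case by (simp add: inputs_def)
next
  case (dec x)
  have w: "(w, w) \<in> simI M" "w \<in> worlds M"
    using component_worlds dec.prems simI_refl by auto
  \<comment> \<open>The classifier returns the value of some decision atom true at \<open>w\<close>;
    this value is \<open>x\<close> exactly when the atom of \<open>x\<close> is true there.\<close>
  then show ?case
    using classifier_of_eq[OF w(1) dec.prems] decision_exists by auto
next
  case (boxI \<phi>)
  let ?f = "classifier_of M (component M w0)" and ?true = "mcm_true (mcm_of_mdm M w0)"
  have "?true (inputs M v) (?f w) \<phi>"
    if hyp: "\<forall>v. (w, v) \<in> simI M \<longrightarrow> mdm_true M v \<phi>" and v: "v \<in> component M w0" for v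
  proof -
    \<comment> \<open>\<open>u\<close> combines the inputs of \<open>v\<close> with the classifier
      of \<open>w\<close>, so it stands for the required pair.\<close>
    obtain u where u: "(w, u) \<in> simI M" "(u, v) \<in> simF M"
      using component_connected boxI.prems v by blast
    then have "?true (inputs M u) (?f u) \<phi>"
      using hyp boxI component_simI by blast
    then show ?thesis
      using u simF_inputs classifier_of_cong by metis
  qed
  moreover have "mdm_true M v \<phi>"
    if "\<forall>v\<in>component M w0. ?true (inputs M v) (?f w) \<phi>" "(w, v) \<in> simI M" for v
    using that boxI component_simI classifier_of_cong by metis
  ultimately show ?case by (auto simp: mcm_of_mdm_def)
next
  case (boxF \<phi>)
  let ?f = "classifier_of M (component M w0)" and ?true = "mcm_true (mcm_of_mdm M w0)"
  have "?true (inputs M w) (?f v) \<phi>"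
    if hyp: "\<forall>v. (w, v) \<in> simF M \<longrightarrow> mdm_true M v \<phi>" and v: "v \<in> component M w0" for v
  proof -
    \<comment> \<open>Here (C1) reverses the order of the steps: \<open>u\<close> must keep the
      inputs of \<open>w\<close> and take the classifier of \<open>v\<close>.\<close>
    obtain u where u: "(w, u) \<in> simF M" "(u, v) \<in> simI M"
      using component_connected boxF.prems v commute by blast
    then have "?true (inputs M u) (?f u) \<phi>"
      using hyp boxF component_simF by blast
    then show ?thesis
      using u simF_inputs classifier_of_cong by metis
  qed
  moreover have "mdm_true M v \<phi>"
    if "\<forall>v\<in>component M w0. ?true (inputs M w) (?f v) \<phi>" "(w, v) \<in> simF M" for v
    using that boxF component_simF simF_inputs by metis
  ultimately show ?case by (auto simp: mcm_of_mdm_def)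
qed auto

end

end

text \<open>The type of worlds is arbitrary, so this serves both for pairs as worlds and for any
  other type.\<close>

lemma mdm_satisfiable_imp_mcm_satisfiable:
  fixes Atm0 :: "'p set" and Val :: "'v set"
  assumes "\<phi> \<in> language Atm0 Val" "mdm_satisfiable TYPE('w) Atm0 Val \<phi>"
  shows "mcm_satisfiable Atm0 Val \<phi>"
proof -
  obtain M :: "('w, 'p, 'v) mdm" and w
    where M: "is_mdm Atm0 Val M" and w: "w \<in> worlds M" and true: "mdm_true M w \<phi>"
    using assms(2) by (auto simp: mdm_satisfiable_def)
  have self: "w \<in> component M w"
    by (rule self_in_component[OF M w])
  then have "mcm_true (mcm_of_mdm M w) (inputs M w) (classifier_of M (component M w) w) \<phi>"
    using mcm_true_mcm_of_mdm[OF M w assms(1) self] true by simp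
  moreover have "inputs M w \<in> states (mcm_of_mdm M w)"
    and "classifier_of M (component M w) w \<in> classifiers (mcm_of_mdm M w)"
    using self by (auto simp: mcm_of_mdm_def)
  ultimately show ?thesis
    unfolding mcm_satisfiable_def using is_mcm_mcm_of_mdm[OF M w] by blast
qed

theorem theorem1:
  fixes Atm0 :: "'p set" and Val :: "'v set" and \<phi> :: "('p, 'v) fm"
  assumes "countable Atm0" and "finite Val" and "\<phi> \<in> language Atm0 Val"
  shows "(mcm_satisfiable Atm0 Val \<phi> \<longleftrightarrow>
            mdm_satisfiable TYPE('p set \<times> ('p set \<Rightarrow> 'v)) Atm0 Val \<phi>) \<and>
         (mdm_satisfiable TYPE('w) Atm0 Val \<phi> \<longrightarrow> mcm_satisfiable Atm0 Val \<phi>)"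
  by (rule conjI[OF iffI[OF mcm_satisfiable_imp_mdm_satisfiable
        mdm_satisfiable_imp_mcm_satisfiable[OF assms(3)]]
      impI[OF mdm_satisfiable_imp_mcm_satisfiable[OF assms(3)]]])

end
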